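(* Let $(X,\mathcal{A},\nu)$ be a finite measure space, and let $f_1,\dots,f_n$ be nonnegative (real-valued) measurable functions on $X$. For a nonnegative measurable function $f$ on $X$ put $$\varphi(f)=\int_X\frac{f}{1+f}\,d\nu.$$ Let $\mu=(\mu_1,\dots,\mu_m)$ and $\lambda=(\lambda_1,\dots,\lambda_n)$ be probability vectors, and let $\omega_1,\omega_2$ be two weight functions with respect to $\mu$ and $\lambda$. Then $$\sum_{j=1}^n\lambda_j\varphi(f_j)\le\nu(X)-\sum_{i=1}^m\mu_i\left\|L^{-1}\left(1+\sum_{j=1}^n\omega_1(i,j)\lambda_jf_j,\ 1+\sum_{j=1}^n\omega_2(i,j)\lambda_jf_j\right)\right\|_1\le\varphi\left(\sum_{j=1}^n\lambda_jf_j\right).$$ In particular, if $B=[b_{ij}]_{n\times n}$ and $C=[c_{ij}]_{n\times n}$ are two double stochastic matrices, then $$\frac{\varphi(f_1)+\cdots+\varphi(f_n)}{n}\le\nu(X)-\frac1n\sum_{i=1}^n\left\|L^{-1}\left(1+\sum_{j=1}^nb_{ij}f_j,\ 1+\sum_{j=1}^nc_{ij}f_j\right)\right\|_1\le\varphi\left(\frac{f_1+\cdots+f_n}{n}\right).$$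
   Context: $m,n\ge1$ are integers. Probability vectors: $\mu_i\ge0$, $\lambda_j\ge0$, $\sum_{i=1}^m\mu_i=1$, $\sum_{j=1}^n\lambda_j=1$. A weight function with respect to $\mu$ and $\lambda$ is a map $\omega:\{1,\dots,m\}\times\{1,\dots,n\}\to[0,\infty)$ such that $\sum_{i=1}^m\omega(i,j)\mu_i=1$ for every $j=1,\dots,n$ and $\sum_{j=1}^n\omega(i,j)\lambda_j=1$ for every $i=1,\dots,m$. A double stochastic matrix is a square matrix with nonnegative real entries each of whose rows and columns sums to $1$. The logarithmic mean of $a,b>0$ is $L(a,b)=a$ if $a=b$, and $L(a,b)=\frac{b-a}{\ln b-\ln a}$ if $a\ne b$; $L^{-1}(a,b)$ denotes $1/L(a,b)$. For positive functions $g,h$ on $X$, $L^{-1}(g,h)$ is the function $x\mapsto 1/L(g(x),h(x))$. $\|\cdot\|_1$ is the norm of $L^1(\nu)$. *)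

theory Defs
  imports "HOL-Analysis.Analysis"
begin

text \<open>
  Vectors and matrices are functions on natural numbers, and only their values at indices in
  \<open>{1..m}\<close> and \<open>{1..n}\<close> matter.
\<close>

definition prob_vector :: "nat \<Rightarrow> (nat \<Rightarrow> real) \<Rightarrow> bool" where
  "prob_vector n p \<longleftrightarrow> (\<forall>i\<in>{1..n}. 0 \<le> p i) \<and> (\<Sum>i=1..n. p i) = 1"

definition weight_function ::
    "nat \<Rightarrow> nat \<Rightarrow> (nat \<Rightarrow> real) \<Rightarrow> (nat \<Rightarrow> real) \<Rightarrow> (nat \<Rightarrow> nat \<Rightarrow> real) \<Rightarrow> bool" where
  "weight_function m n \<mu> lam \<omega> \<longleftrightarrow>
     (\<forall>i\<in>{1..m}. \<forall>j\<in>{1..n}. 0 \<le> \<omega> i j) \<and>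
     (\<forall>j\<in>{1..n}. (\<Sum>i=1..m. \<omega> i j * \<mu> i) = 1) \<and>
     (\<forall>i\<in>{1..m}. (\<Sum>j=1..n. \<omega> i j * lam j) = 1)"

definition double_stochastic :: "nat \<Rightarrow> (nat \<Rightarrow> nat \<Rightarrow> real) \<Rightarrow> bool" where
  "double_stochastic n B \<longleftrightarrow>
     (\<forall>i\<in>{1..n}. \<forall>j\<in>{1..n}. 0 \<le> B i j) \<and>
     (\<forall>i\<in>{1..n}. (\<Sum>j=1..n. B i j) = 1) \<and>
     (\<forall>j\<in>{1..n}. (\<Sum>i=1..n. B i j) = 1)"

text \<open>The logarithmic mean, meant for \<open>a, b > 0\<close>.\<close>

definition log_mean :: "real \<Rightarrow> real \<Rightarrow> real" where
  "log_mean a b = (if a = b then a else (b - a) / (ln b - ln a))"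

definition inv_log_mean :: "real \<Rightarrow> real \<Rightarrow> real" where
  "inv_log_mean a b = 1 / log_mean a b"

text \<open>
  The Bochner integral is \<open>0\<close> on functions that are not integrable. The two integrals below are
  only used where the integrand is measurable with values in \<open>[0, 1]\<close> and the measure is finite,
  so that integrability holds.
\<close>

definition L1_norm :: "'a measure \<Rightarrow> ('a \<Rightarrow> real) \<Rightarrow> real" where
  "L1_norm M g = (\<integral>x. \<bar>g x\<bar> \<partial>M)"

definition phi :: "'a measure \<Rightarrow> ('a \<Rightarrow> real) \<Rightarrow> real" where
  "phi M f = (\<integral>x. f x / (1 + f x) \<partial>M)"

end

theory Submission
  imports Defs
begin

text \<open>
  Since \<open>t / (1 + t) = 1 - 1 / (1 + t)\<close>, the theorem is the integrated form of the pointwise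
  estimate
  \<open>1 / (1 + (\<Sum>j. \<lambda>\<^sub>j f\<^sub>j)) \<le> (\<Sum>i. \<mu>\<^sub>i / L(a\<^sub>i, b\<^sub>i)) \<le> (\<Sum>j. \<lambda>\<^sub>j / (1 + f\<^sub>j))\<close>,
  where \<open>a\<^sub>i\<close> and \<open>b\<^sub>i\<close> are the means of the numbers \<open>1 + f\<^sub>j\<close> with weights
  \<open>\<omega>\<^sub>1(i,j) \<lambda>\<^sub>j\<close> and \<open>\<omega>\<^sub>2(i,j) \<lambda>\<^sub>j\<close>. All three expressions lie in \<open>[0, 1]\<close>, so they are
  integrable over a finite measure.

  The pointwise estimate comes from the convexity of \<open>1/t\<close>, used in two ways. As
  \<open>1 / L(a, b)\<close> is the average of \<open>1/t\<close> over the interval between \<open>a\<close> and \<open>b\<close>, the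
  Hermite-Hadamard inequality places it between \<open>2 / (a + b)\<close> and \<open>(1/a + 1/b) / 2\<close>
  (\<open>inv_log_mean_ge\<close>, \<open>inv_log_mean_le\<close>). These bounds reduce both estimates to Jensen's
  inequality (\<open>inverse_weighted_mean_le\<close>): for the upper one, Jensen in the index \<open>j\<close> bounds
  each \<open>1 / a\<^sub>i\<close> and each \<open>1 / b\<^sub>i\<close>, and the column condition on the weights removes them after
  summation over \<open>i\<close>; for the lower one, Jensen in the index \<open>i\<close> is applied to the midpoints
  \<open>(a\<^sub>i + b\<^sub>i) / 2\<close>, whose \<open>\<mu>\<close>-mean is \<open>1 + (\<Sum>j. \<lambda>\<^sub>j f\<^sub>j)\<close> by the same column condition.

  Double stochastic matrices \<open>B\<close> correspond to the weight functions \<open>n B\<close> with respect to the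
  uniform vectors.
\<close>

section \<open>Bounds for the inverse logarithmic mean\<close>

lemma inv_log_mean_commute: "inv_log_mean a b = inv_log_mean b a"
  by (simp add: inv_log_mean_def log_mean_def) (metis minus_diff_eq minus_divide_divide)

text \<open>
  The midpoint half of the Hermite-Hadamard inequality for \<open>1/t\<close>: the logarithmic mean is at
  most the arithmetic mean.
\<close>

lemma inv_log_mean_ge:
  assumes "0 < a" "0 < b"
  shows "2 / (a + b) \<le> inv_log_mean a b"
proof -
  have less: "2 / (a + b) \<le> inv_log_mean a b" if "0 < a" "a < b" for a b :: real
    using ln_inverse_approx_ge[OF that] that
    by (simp add: inv_log_mean_def log_mean_def field_simps)
  consider "a < b" | "b < a" | "a = b" by linarith
  then show ?thesis
  proof cases
    case 1
    with less assms show ?thesis by blast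
  next
    case 2
    with less[of b a] assms show ?thesis
      by (simp add: inv_log_mean_commute add.commute)
  next
    case 3
    then show ?thesis by (simp add: inv_log_mean_def log_mean_def)
  qed
qed

text \<open>
  The trapezoidal half of the Hermite-Hadamard inequality for \<open>1/t\<close>: the logarithmic mean is
  at least the harmonic mean.
\<close>

lemma inv_log_mean_le:
  assumes "0 < a" "0 < b"
  shows "inv_log_mean a b \<le> (1 / a + 1 / b) / 2"
proof -
  have less: "inv_log_mean a b \<le> (1 / a + 1 / b) / 2" if "0 < a" "a < b" for a b :: real
  proof -
    have "ln b - ln a \<le> (b - a) * ((1 / a + 1 / b) / 2)"
      using ln_inverse_approx_le[of a "b - a"] that by (simp add: inverse_eq_divide)
    then have "(ln b - ln a) / (b - a) \<le> (1 / a + 1 / b) / 2"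
      using that by (simp add: pos_divide_le_eq mult.commute)
    then show ?thesis
      using that by (simp add: inv_log_mean_def log_mean_def)
  qed
  consider "a < b" | "b < a" | "a = b" by linarith
  then show ?thesis
  proof cases
    case 1
    with less assms show ?thesis by blast
  next
    case 2
    with less[of b a] assms show ?thesis
      by (simp add: inv_log_mean_commute add.commute)
  next
    case 3
    then show ?thesis by (simp add: inv_log_mean_def log_mean_def)
  qed
qed

text \<open>
  In the application both arguments have the form \<open>1 + g\<close> with \<open>g \<ge> 0\<close>; the bounds give the
  integrability of the inverse logarithmic mean and let its \<open>L\<^sup>1\<close> norm be read as an integral.
\<close>

lemma inv_log_mean_bounds:
  assumes "1 \<le> a" "1 \<le> b"
  shows "0 \<le> inv_log_mean a b" "inv_log_mean a b \<le> 1"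
proof -
  have "0 \<le> 2 / (a + b)" using assms by simp
  also have "\<dots> \<le> inv_log_mean a b" using assms by (intro inv_log_mean_ge) auto
  finally show "0 \<le> inv_log_mean a b" .
  have "inv_log_mean a b \<le> (1 / a + 1 / b) / 2"
    using assms by (intro inv_log_mean_le) auto
  also have "\<dots> \<le> (1 + 1) / 2"
    using assms by (intro divide_right_mono add_mono) auto
  finally show "inv_log_mean a b \<le> 1" by simp
qed

lemma borel_measurable_inv_log_mean [measurable]:
  assumes [measurable]: "g \<in> borel_measurable M" "h \<in> borel_measurable M"
  shows "(\<lambda>x. inv_log_mean (g x) (h x)) \<in> borel_measurable M"
  unfolding inv_log_mean_def log_mean_def by measurable

section \<open>The pointwise estimate\<close>

lemma inverse_weighted_mean_le:
  fixes p y :: "'i \<Rightarrow> real"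
  assumes "finite I" "\<And>i. i \<in> I \<Longrightarrow> 0 \<le> p i" "(\<Sum>i\<in>I. p i) = 1" "\<And>i. i \<in> I \<Longrightarrow> 0 < y i"
  shows "1 / (\<Sum>i\<in>I. p i * y i) \<le> (\<Sum>i\<in>I. p i / y i)"
proof -
  have "I \<noteq> {}" using assms(3) by auto
  moreover have "convex_on {0<..} (inverse :: real \<Rightarrow> real)"
    by (intro convex_on_inverse) auto
  ultimately have "inverse (\<Sum>i\<in>I. p i *\<^sub>R y i) \<le> (\<Sum>i\<in>I. p i * inverse (y i))"
    using assms by (intro convex_on_sum[where C = "{0<..}"]) auto
  then show ?thesis by (simp add: divide_inverse)
qed

text \<open>
  The rows of a weight function are the weights of genuine averages, so adding \<open>1\<close> to the data
  adds \<open>1\<close> to the average.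
\<close>

lemma one_plus_row_mean:
  assumes "weight_function m n \<mu> lam \<omega>" "i \<in> {1..m}"
  shows "1 + (\<Sum>j=1..n. \<omega> i j * lam j * t j) = (\<Sum>j=1..n. \<omega> i j * lam j * (1 + t j))"
  using assms by (simp add: weight_function_def distrib_left sum.distrib)

lemma one_plus_row_mean_ge_1:
  assumes "weight_function m n \<mu> lam \<omega>" "prob_vector n lam" "i \<in> {1..m}"
    and "\<And>j. j \<in> {1..n} \<Longrightarrow> 0 \<le> t j"
  shows "1 \<le> 1 + (\<Sum>j=1..n. \<omega> i j * lam j * t j)"
  using assms by (auto simp: weight_function_def prob_vector_def intro!: sum_nonneg mult_nonneg_nonneg)

text \<open>Averaging over \<open>i\<close> as well undoes the weights, because the columns are normalised too.\<close>

lemma weight_function_double_sum: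
  assumes "weight_function m n \<mu> lam \<omega>"
  shows "(\<Sum>i=1..m. \<mu> i * (\<Sum>j=1..n. \<omega> i j * lam j * t j)) = (\<Sum>j=1..n. lam j * t j)"
proof -
  have "(\<Sum>i=1..m. \<mu> i * (\<Sum>j=1..n. \<omega> i j * lam j * t j))
      = (\<Sum>j=1..n. (\<Sum>i=1..m. \<omega> i j * \<mu> i) * (lam j * t j))"
    unfolding sum_distrib_left sum_distrib_right
    by (subst sum.swap) (simp add: mult_ac)
  also have "\<dots> = (\<Sum>j=1..n. lam j * t j)"
    using assms by (intro sum.cong) (auto simp: weight_function_def)
  finally show ?thesis .
qed

lemma sum_inverse_row_mean_le:
  assumes "weight_function m n \<mu> lam \<omega>" "prob_vector m \<mu>" "prob_vector n lam"
    and t: "\<And>j. j \<in> {1..n} \<Longrightarrow> 0 \<le> t j"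
  shows "(\<Sum>i=1..m. \<mu> i * (1 / (1 + (\<Sum>j=1..n. \<omega> i j * lam j * t j))))
       \<le> (\<Sum>j=1..n. lam j * (1 / (1 + t j)))"
proof -
  have "1 / (1 + (\<Sum>j=1..n. \<omega> i j * lam j * t j)) \<le> (\<Sum>j=1..n. \<omega> i j * lam j / (1 + t j))"
    if "i \<in> {1..m}" for i
    unfolding one_plus_row_mean[OF assms(1) that]
    using assms that
    by (intro inverse_weighted_mean_le) (auto simp: weight_function_def prob_vector_def add_pos_nonneg)
  then have "(\<Sum>i=1..m. \<mu> i * (1 / (1 + (\<Sum>j=1..n. \<omega> i j * lam j * t j))))
      \<le> (\<Sum>i=1..m. \<mu> i * (\<Sum>j=1..n. \<omega> i j * lam j * (1 / (1 + t j))))"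
    using assms(2) by (intro sum_mono mult_left_mono) (auto simp: prob_vector_def)
  also have "\<dots> = (\<Sum>j=1..n. lam j * (1 / (1 + t j)))"
    by (rule weight_function_double_sum[OF assms(1)])
  finally show ?thesis .
qed

lemma sum_inv_log_mean_le:
  assumes w: "weight_function m n \<mu> lam \<omega>1" "weight_function m n \<mu> lam \<omega>2"
    and p: "prob_vector m \<mu>" "prob_vector n lam"
    and t: "\<And>j. j \<in> {1..n} \<Longrightarrow> 0 \<le> t j"
  shows "(\<Sum>i=1..m. \<mu> i * inv_log_mean
            (1 + (\<Sum>j=1..n. \<omega>1 i j * lam j * t j)) (1 + (\<Sum>j=1..n. \<omega>2 i j * lam j * t j)))
       \<le> (\<Sum>j=1..n. lam j * (1 / (1 + t j)))"
proof -
  define a where "a = (\<lambda>i. 1 + (\<Sum>j=1..n. \<omega>1 i j * lam j * t j))"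
  define b where "b = (\<lambda>i. 1 + (\<Sum>j=1..n. \<omega>2 i j * lam j * t j))"
  have pos: "0 < a i" "0 < b i" if "i \<in> {1..m}" for i
    using one_plus_row_mean_ge_1[where t = t, OF w(1) p(2) that t]
      one_plus_row_mean_ge_1[where t = t, OF w(2) p(2) that t]
    by (auto simp: a_def b_def)
  have "(\<Sum>i=1..m. \<mu> i * inv_log_mean (a i) (b i))
      \<le> (\<Sum>i=1..m. \<mu> i * ((1 / a i + 1 / b i) / 2))"
    using p(1) pos by (intro sum_mono mult_left_mono inv_log_mean_le) (auto simp: prob_vector_def)
  also have "\<dots> = ((\<Sum>i=1..m. \<mu> i * (1 / a i)) + (\<Sum>i=1..m. \<mu> i * (1 / b i))) / 2"
    by (simp add: sum.distrib[symmetric] sum_divide_distrib distrib_left)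
  also have "\<dots> \<le> (\<Sum>j=1..n. lam j * (1 / (1 + t j)))"
    unfolding a_def b_def
    by (intro order.trans[OF divide_right_mono[OF add_mono[OF
          sum_inverse_row_mean_le[OF w(1) p] sum_inverse_row_mean_le[OF w(2) p]]]])
       (simp_all add: t)
  finally show ?thesis unfolding a_def b_def .
qed

lemma sum_inv_log_mean_ge:
  assumes w: "weight_function m n \<mu> lam \<omega>1" "weight_function m n \<mu> lam \<omega>2"
    and p: "prob_vector m \<mu>" "prob_vector n lam"
    and t: "\<And>j. j \<in> {1..n} \<Longrightarrow> 0 \<le> t j"
  shows "1 / (1 + (\<Sum>j=1..n. lam j * t j))
       \<le> (\<Sum>i=1..m. \<mu> i * inv_log_mean
            (1 + (\<Sum>j=1..n. \<omega>1 i j * lam j * t j)) (1 + (\<Sum>j=1..n. \<omega>2 i j * lam j * t j)))"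
proof -
  define a where "a = (\<lambda>i. 1 + (\<Sum>j=1..n. \<omega>1 i j * lam j * t j))"
  define b where "b = (\<lambda>i. 1 + (\<Sum>j=1..n. \<omega>2 i j * lam j * t j))"
  have pos: "0 < a i" "0 < b i" if "i \<in> {1..m}" for i
    using one_plus_row_mean_ge_1[where t = t, OF w(1) p(2) that t]
      one_plus_row_mean_ge_1[where t = t, OF w(2) p(2) that t]
    by (auto simp: a_def b_def)
  have mean: "(\<Sum>i=1..m. \<mu> i * a i) = 1 + (\<Sum>j=1..n. lam j * t j)"
    "(\<Sum>i=1..m. \<mu> i * b i) = 1 + (\<Sum>j=1..n. lam j * t j)"
    using p(1) weight_function_double_sum[OF w(1)] weight_function_double_sum[OF w(2)]
    by (simp_all add: a_def b_def distrib_left sum.distrib prob_vector_def)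
  have "(\<Sum>i=1..m. \<mu> i * ((a i + b i) / 2))
      = ((\<Sum>i=1..m. \<mu> i * a i) + (\<Sum>i=1..m. \<mu> i * b i)) / 2"
    by (simp add: sum.distrib[symmetric] sum_divide_distrib distrib_left)
  also have "\<dots> = 1 + (\<Sum>j=1..n. lam j * t j)"
    by (simp only: mean) simp
  finally have "1 / (1 + (\<Sum>j=1..n. lam j * t j)) = 1 / (\<Sum>i=1..m. \<mu> i * ((a i + b i) / 2))"
    by simp
  also have "\<dots> \<le> (\<Sum>i=1..m. \<mu> i / ((a i + b i) / 2))"
    using p(1) pos
    by (intro inverse_weighted_mean_le) (auto simp: prob_vector_def intro: add_pos_pos)
  also have "\<dots> = (\<Sum>i=1..m. \<mu> i * (2 / (a i + b i)))"
    by (simp add: mult.commute)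
  also have "\<dots> \<le> (\<Sum>i=1..m. \<mu> i * inv_log_mean (a i) (b i))"
    using p(1) pos by (intro sum_mono mult_left_mono inv_log_mean_ge) (auto simp: prob_vector_def)
  finally show ?thesis unfolding a_def b_def .
qed

section \<open>Integration\<close>

lemma (in finite_measure) integrable_inverse_one_plus:
  fixes g :: "'a \<Rightarrow> real"
  assumes [measurable]: "g \<in> borel_measurable M" and "\<And>x. x \<in> space M \<Longrightarrow> 0 \<le> g x"
  shows "integrable M (\<lambda>x. 1 / (1 + g x))"
  using assms(2)
  by (intro integrable_const_bound[where B = 1])
     (auto intro!: AE_I2 simp: divide_le_eq_1 add_pos_nonneg)

lemma (in finite_measure) phi_eq:
  assumes "g \<in> borel_measurable M" and nonneg: "\<And>x. x \<in> space M \<Longrightarrow> 0 \<le> g x"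
  shows "phi M g = measure M (space M) - (\<integral>x. 1 / (1 + g x) \<partial>M)"
proof -
  have "phi M g = (\<integral>x. 1 - 1 / (1 + g x) \<partial>M)"
    unfolding phi_def
  proof (rule Bochner_Integration.integral_cong)
    fix x assume "x \<in> space M"
    then have "1 + g x \<noteq> 0" using nonneg[of x] by linarith
    then show "g x / (1 + g x) = 1 - 1 / (1 + g x)" by (simp add: field_simps)
  qed simp
  also have "\<dots> = measure M (space M) - (\<integral>x. 1 / (1 + g x) \<partial>M)"
    using integrable_inverse_one_plus[OF assms] by (subst Bochner_Integration.integral_diff) auto
  finally show ?thesis .
qed

lemma (in finite_measure) integrable_inv_log_mean:
  assumes [measurable]: "g \<in> borel_measurable M" "h \<in> borel_measurable M"
    and "\<And>x. x \<in> space M \<Longrightarrow> 1 \<le> g x" "\<And>x. x \<in> space M \<Longrightarrow> 1 \<le> h x"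
  shows "integrable M (\<lambda>x. inv_log_mean (g x) (h x))"
  using assms inv_log_mean_bounds
  by (intro integrable_const_bound[where B = 1]) (auto intro!: AE_I2 simp: abs_le_iff)

lemma L1_norm_inv_log_mean:
  assumes "\<And>x. x \<in> space M \<Longrightarrow> 1 \<le> g x" "\<And>x. x \<in> space M \<Longrightarrow> 1 \<le> h x"
  shows "L1_norm M (\<lambda>x. inv_log_mean (g x) (h x)) = (\<integral>x. inv_log_mean (g x) (h x) \<partial>M)"
  unfolding L1_norm_def using assms inv_log_mean_bounds
  by (intro Bochner_Integration.integral_cong) auto

lemma (in finite_measure) phi_weighted_bounds:
  assumes f [measurable]: "\<And>j. j \<in> {1..n} \<Longrightarrow> f j \<in> borel_measurable M"
    and nonneg: "\<And>j x. j \<in> {1..n} \<Longrightarrow> x \<in> space M \<Longrightarrow> 0 \<le> f j x"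
    and p: "prob_vector m \<mu>" "prob_vector n lam"
    and w: "weight_function m n \<mu> lam \<omega>1" "weight_function m n \<mu> lam \<omega>2"
  defines "K \<equiv> (\<Sum>i=1..m. \<mu> i * L1_norm M (\<lambda>x. inv_log_mean
      (1 + (\<Sum>j=1..n. \<omega>1 i j * lam j * f j x)) (1 + (\<Sum>j=1..n. \<omega>2 i j * lam j * f j x))))"
  shows "(\<Sum>j=1..n. lam j * phi M (f j)) \<le> measure M (space M) - K" (is ?lower)
    and "measure M (space M) - K \<le> phi M (\<lambda>x. \<Sum>j=1..n. lam j * f j x)" (is ?upper)
proof -
  define a where "a = (\<lambda>i x. 1 + (\<Sum>j=1..n. \<omega>1 i j * lam j * f j x))"
  define b where "b = (\<lambda>i x. 1 + (\<Sum>j=1..n. \<omega>2 i j * lam j * f j x))"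
  have [measurable]: "a i \<in> borel_measurable M" "b i \<in> borel_measurable M" for i
    unfolding a_def b_def by (auto intro!: borel_measurable_add borel_measurable_sum borel_measurable_times)
  have ge1: "1 \<le> a i x" "1 \<le> b i x" if "i \<in> {1..m}" "x \<in> space M" for i x
    unfolding a_def b_def
    using nonneg that(2)
    by (intro one_plus_row_mean_ge_1[OF w(1) p(2) that(1)]
        one_plus_row_mean_ge_1[OF w(2) p(2) that(1)]; blast)+
  have int: "integrable M (\<lambda>x. inv_log_mean (a i x) (b i x))" if "i \<in> {1..m}" for i
    using ge1[OF that] by (intro integrable_inv_log_mean) auto
  then have int_sum: "integrable M (\<lambda>x. \<Sum>i=1..m. \<mu> i * inv_log_mean (a i x) (b i x))"
    by (intro Bochner_Integration.integrable_sum) auto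
  have "K = (\<Sum>i=1..m. \<mu> i * L1_norm M (\<lambda>x. inv_log_mean (a i x) (b i x)))"
    by (simp only: K_def a_def b_def)
  also have "\<dots> = (\<Sum>i=1..m. \<mu> i * (\<integral>x. inv_log_mean (a i x) (b i x) \<partial>M))"
    using ge1 by (intro sum.cong) (auto simp: L1_norm_inv_log_mean)
  also have "\<dots> = (\<integral>x. (\<Sum>i=1..m. \<mu> i * inv_log_mean (a i x) (b i x)) \<partial>M)"
    using int by (subst Bochner_Integration.integral_sum) auto
  finally have K: "K = (\<integral>x. (\<Sum>i=1..m. \<mu> i * inv_log_mean (a i x) (b i x)) \<partial>M)" .

  have int_f: "integrable M (\<lambda>x. 1 / (1 + f j x))" if "j \<in> {1..n}" for j
    using f nonneg that by (intro integrable_inverse_one_plus) auto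
  have "K \<le> (\<integral>x. (\<Sum>j=1..n. lam j * (1 / (1 + f j x))) \<partial>M)"
    unfolding K
  proof (rule integral_mono[OF int_sum])
    show "integrable M (\<lambda>x. \<Sum>j=1..n. lam j * (1 / (1 + f j x)))"
      using int_f by (intro Bochner_Integration.integrable_sum integrable_mult_right) auto
    show "(\<Sum>i=1..m. \<mu> i * inv_log_mean (a i x) (b i x)) \<le> (\<Sum>j=1..n. lam j * (1 / (1 + f j x)))"
      if "x \<in> space M" for x
      unfolding a_def b_def using nonneg that by (intro sum_inv_log_mean_le[OF w p]) auto
  qed
  also have "\<dots> = (\<Sum>j=1..n. lam j * (\<integral>x. 1 / (1 + f j x) \<partial>M))"
    using int_f
    by (subst Bochner_Integration.integral_sum; intro integrable_mult_right sum.cong refl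
        integral_mult_right_zero) auto
  also have "\<dots> = (\<Sum>j=1..n. lam j * (measure M (space M) - phi M (f j)))"
    using f nonneg by (intro sum.cong) (auto simp: phi_eq)
  also have "\<dots> = measure M (space M) - (\<Sum>j=1..n. lam j * phi M (f j))"
    using p(2)
    by (simp add: right_diff_distrib sum_subtractf sum_distrib_right[symmetric] prob_vector_def)
  finally show ?lower by simp

  define g where "g = (\<lambda>x. \<Sum>j=1..n. lam j * f j x)"
  have g: "g \<in> borel_measurable M" "\<And>x. x \<in> space M \<Longrightarrow> 0 \<le> g x"
    using p(2) f nonneg unfolding g_def prob_vector_def
    by (auto intro!: borel_measurable_sum borel_measurable_times sum_nonneg)
  have "(\<integral>x. 1 / (1 + g x) \<partial>M) \<le> K"
    unfolding K
  proof (rule integral_mono[OF integrable_inverse_one_plus[OF g] int_sum])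
    show "1 / (1 + g x) \<le> (\<Sum>i=1..m. \<mu> i * inv_log_mean (a i x) (b i x))"
      if "x \<in> space M" for x
      unfolding a_def b_def g_def using nonneg that by (intro sum_inv_log_mean_ge[OF w p]) auto
  qed
  then show ?upper
    using phi_eq[OF g] by (simp add: g_def)
qed

section \<open>Double stochastic matrices\<close>

lemma prob_vector_uniform:
  assumes "n \<ge> 1"
  shows "prob_vector n (\<lambda>_. 1 / real n)"
  using assms by (simp add: prob_vector_def)

lemma weight_function_double_stochastic:
  assumes "n \<ge> 1" "double_stochastic n B"
  shows "weight_function n n (\<lambda>_. 1 / real n) (\<lambda>_. 1 / real n) (\<lambda>i j. real n * B i j)"
  using assms by (simp add: weight_function_def double_stochastic_def)

theorem theorem3p6:
  fixes M :: "'a measure" and f :: "nat \<Rightarrow> 'a \<Rightarrow> real" and n :: nat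
  assumes "finite_measure M"
    and "n \<ge> 1"
    and "\<And>j. j \<in> {1..n} \<Longrightarrow> f j \<in> borel_measurable M"
    and "\<And>j x. j \<in> {1..n} \<Longrightarrow> x \<in> space M \<Longrightarrow> 0 \<le> f j x"
  shows "(\<forall>(m::nat) (\<mu>::nat \<Rightarrow> real) (lam::nat \<Rightarrow> real)
            (\<omega>1::nat \<Rightarrow> nat \<Rightarrow> real) (\<omega>2::nat \<Rightarrow> nat \<Rightarrow> real).
            m \<ge> 1 \<longrightarrow> prob_vector m \<mu> \<longrightarrow> prob_vector n lam \<longrightarrow>
            weight_function m n \<mu> lam \<omega>1 \<longrightarrow> weight_function m n \<mu> lam \<omega>2 \<longrightarrow>
            (\<Sum>j=1..n. lam j * phi M (f j))
              \<le> measure M (space M)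
                - (\<Sum>i=1..m. \<mu> i * L1_norm M (\<lambda>x. inv_log_mean
                    (1 + (\<Sum>j=1..n. \<omega>1 i j * lam j * f j x))
                    (1 + (\<Sum>j=1..n. \<omega>2 i j * lam j * f j x))))
            \<and> measure M (space M)
                - (\<Sum>i=1..m. \<mu> i * L1_norm M (\<lambda>x. inv_log_mean
                    (1 + (\<Sum>j=1..n. \<omega>1 i j * lam j * f j x))
                    (1 + (\<Sum>j=1..n. \<omega>2 i j * lam j * f j x))))
              \<le> phi M (\<lambda>x. \<Sum>j=1..n. lam j * f j x))
       \<and> (\<forall>(B::nat \<Rightarrow> nat \<Rightarrow> real) (C::nat \<Rightarrow> nat \<Rightarrow> real).
            double_stochastic n B \<longrightarrow> double_stochastic n C \<longrightarrow>
            (\<Sum>j=1..n. phi M (f j)) / real n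
              \<le> measure M (space M)
                - 1 / real n * (\<Sum>i=1..n. L1_norm M (\<lambda>x. inv_log_mean
                    (1 + (\<Sum>j=1..n. B i j * f j x))
                    (1 + (\<Sum>j=1..n. C i j * f j x))))
            \<and> measure M (space M)
                - 1 / real n * (\<Sum>i=1..n. L1_norm M (\<lambda>x. inv_log_mean
                    (1 + (\<Sum>j=1..n. B i j * f j x))
                    (1 + (\<Sum>j=1..n. C i j * f j x))))
              \<le> phi M (\<lambda>x. (\<Sum>j=1..n. f j x) / real n))"
proof (intro conjI allI impI)
  interpret finite_measure M by fact
  note f = assms(3,4)
  {
    fix m :: nat and \<mu> lam :: "nat \<Rightarrow> real" and \<omega>1 \<omega>2 :: "nat \<Rightarrow> nat \<Rightarrow> real"
    assume "prob_vector m \<mu>" "prob_vector n lam"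
      "weight_function m n \<mu> lam \<omega>1" "weight_function m n \<mu> lam \<omega>2"
    note bounds = phi_weighted_bounds[OF f this]
    show "(\<Sum>j=1..n. lam j * phi M (f j))
        \<le> measure M (space M)
          - (\<Sum>i=1..m. \<mu> i * L1_norm M (\<lambda>x. inv_log_mean
              (1 + (\<Sum>j=1..n. \<omega>1 i j * lam j * f j x))
              (1 + (\<Sum>j=1..n. \<omega>2 i j * lam j * f j x))))"
      by (rule bounds(1))
    show "measure M (space M)
          - (\<Sum>i=1..m. \<mu> i * L1_norm M (\<lambda>x. inv_log_mean
              (1 + (\<Sum>j=1..n. \<omega>1 i j * lam j * f j x))
              (1 + (\<Sum>j=1..n. \<omega>2 i j * lam j * f j x))))
        \<le> phi M (\<lambda>x. \<Sum>j=1..n. lam j * f j x)"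
      by (rule bounds(2))
  next
    fix B C :: "nat \<Rightarrow> nat \<Rightarrow> real"
    assume B: "double_stochastic n B" and C: "double_stochastic n C"
    have u: "prob_vector n (\<lambda>_. 1 / real n)"
      using \<open>n \<ge> 1\<close> by (rule prob_vector_uniform)
    have cancel: "real n * c * (1 / real n) = c" for c
      using \<open>n \<ge> 1\<close> by simp
    note bounds = phi_weighted_bounds[OF f u u
        weight_function_double_stochastic[OF \<open>n \<ge> 1\<close> B]
        weight_function_double_stochastic[OF \<open>n \<ge> 1\<close> C],
        unfolded cancel sum_distrib_left[symmetric]]
    show "(\<Sum>j=1..n. phi M (f j)) / real n
        \<le> measure M (space M)
          - 1 / real n * (\<Sum>i=1..n. L1_norm M (\<lambda>x. inv_log_mean
              (1 + (\<Sum>j=1..n. B i j * f j x))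
              (1 + (\<Sum>j=1..n. C i j * f j x))))"
      using bounds(1) by simp
    show "measure M (space M)
          - 1 / real n * (\<Sum>i=1..n. L1_norm M (\<lambda>x. inv_log_mean
              (1 + (\<Sum>j=1..n. B i j * f j x))
              (1 + (\<Sum>j=1..n. C i j * f j x))))
        \<le> phi M (\<lambda>x. (\<Sum>j=1..n. f j x) / real n)"
      using bounds(2) by simp
  }
qed

end
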